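(* Let $\Bbbk$ be an algebraically closed field of characteristic zero. Canonical forms, under standard-form congruence, for the matrices in $\mathcal{M}_3(\Bbbk)$ with nonzero homogeneous block are given by the following list: \begin{align*} & \begin{pmatrix}1&0&0\\0&0&0\\0&0&0\end{pmatrix},\quad \begin{pmatrix}1&0&0\\0&0&0\\0&0&-1\end{pmatrix},\quad \begin{pmatrix}1&0&0\\0&0&1\\0&0&0\end{pmatrix},\\ & \begin{pmatrix}0&-1&0\\1&1&0\\0&0&0\end{pmatrix},\quad \begin{pmatrix}0&-1&0\\1&1&0\\0&0&1\end{pmatrix},\quad \begin{pmatrix}0&-1&1\\1&1&0\\0&0&0\end{pmatrix},\\ & \begin{pmatrix}0&0&0\\1&0&0\\0&0&0\end{pmatrix},\quad \begin{pmatrix}0&0&0\\1&0&0\\0&0&-1\end{pmatrix},\\ & \begin{pmatrix}0&-1&0\\ q&0&0\\0&0&0\end{pmatrix},\quad \begin{pmatrix}0&-1&0\\ q&0&0\\0&0&1\end{pmatrix}\ (q\in\Bbbk^\times),\quad \begin{pmatrix}0&-1&0\\1&0&1\\0&0&0\end{pmatrix}. \end{align*} That is, every matrix in $\mathcal{M}_3(\Bbbk)$ with nonzero homogeneous block is standard-form congruent to a matrix in this list, and distinct matrices in the list are not standard-form congruent, except that in each of the two families involving $q$ the parameter $q$ is determined up to replacement by $q^{-1}$ (the matrices with parameters $p$ and $q$ in the same family are standard-form congruent if and only if $p=q^{\pm1}$).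
   Context: Write $M \in \mathcal{M}_3(\Bbbk)$ in block form $M=\begin{pmatrix}M_1 & M_2\\ M_3^T & m\end{pmatrix}$ with $M_1\in\mathcal{M}_2(\Bbbk)$, $M_2,M_3\in\Bbbk^2$ (column vectors), $m\in\Bbbk$; $M_1$ is called the homogeneous block of $M$. Define $\mathrm{sf}(M)=\begin{pmatrix}M_1 & M_2+M_3\\ 0 & m\end{pmatrix}$. Let $\mathcal{P}_3=\left\{\begin{pmatrix}P_1&P_2\\0&1\end{pmatrix} : P_1\in \mathrm{GL}_2(\Bbbk),\ P_2\in\Bbbk^2\right\}$. Matrices $M,N\in\mathcal{M}_3(\Bbbk)$ are standard-form congruent if there exist $P\in\mathcal{P}_3$ and $\alpha\in\Bbbk^\times$ with $\mathrm{sf}(M)=\alpha\cdot\mathrm{sf}(P^TNP)$. A canonical form is a distinguished representative of an equivalence class. *)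

theory Defs
  imports "HOL-Analysis.Analysis" "HOL-Computational_Algebra.Polynomial"
begin

text \<open>Matrices are given by their rows: \<open>M $ i $ j\<close> is the entry in row \<open>i\<close> and column \<open>j\<close>.\<close>

definition mat2_of_rows :: "'k::zero list list \<Rightarrow> 'k^2^2"
  where "mat2_of_rows rs = vector (map vector rs)"

definition mat3_of_rows :: "'k::zero list list \<Rightarrow> 'k^3^3"
  where "mat3_of_rows rs = vector (map vector rs)"

text \<open>\<open>block_mat A b c m\<close> is the matrix with blocks \<open>A\<close>, \<open>b\<close> in the first row of blocks
  and \<open>c\<^sup>T\<close>, \<open>m\<close> in the second one.\<close>

definition block_mat :: "'k::zero^2^2 \<Rightarrow> 'k^2 \<Rightarrow> 'k^2 \<Rightarrow> 'k \<Rightarrow> 'k^3^3"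
  where "block_mat A b c m = mat3_of_rows
    [[A$1$1, A$1$2, b$1],
     [A$2$1, A$2$2, b$2],
     [c$1,   c$2,   m  ]]"

definition hom_block :: "'k::zero^3^3 \<Rightarrow> 'k^2^2"
  where "hom_block M = mat2_of_rows [[M$1$1, M$1$2], [M$2$1, M$2$2]]"

definition col_block :: "'k::zero^3^3 \<Rightarrow> 'k^2"
  where "col_block M = vector [M$1$3, M$2$3]"

definition row_block :: "'k::zero^3^3 \<Rightarrow> 'k^2"
  where "row_block M = vector [M$3$1, M$3$2]"

definition corner :: "'k^3^3 \<Rightarrow> 'k"
  where "corner M = M$3$3"

lemma block_mat_blocks: "block_mat (hom_block M) (col_block M) (row_block M) (corner M) = M"
  by (simp add: vec_eq_iff forall_3 block_mat_def mat3_of_rows_def hom_block_def mat2_of_rows_def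
      col_block_def row_block_def corner_def)

definition sf :: "'k::field^3^3 \<Rightarrow> 'k^3^3"
  where "sf M = block_mat (hom_block M) (col_block M + row_block M) 0 (corner M)"

definition P3 :: "('k::field^3^3) set"
  where "P3 = {block_mat P1 P2 0 1 | P1 P2. invertible P1}"

definition sf_congruent :: "'k::field^3^3 \<Rightarrow> 'k^3^3 \<Rightarrow> bool"
  where "sf_congruent M N \<longleftrightarrow>
    (\<exists>P\<in>P3. \<exists>\<alpha>. \<alpha> \<noteq> 0 \<and> sf M = map_matrix ((*) \<alpha>) (sf (transpose P ** N ** P)))"

definition quantum_form :: "'k::field \<Rightarrow> 'k \<Rightarrow> 'k^3^3"
  where "quantum_form m q = mat3_of_rows [[0, -1, 0], [q, 0, 0], [0, 0, m]]"

definition canonical_forms :: "('k::field^3^3) set"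
  where "canonical_forms =
    {mat3_of_rows [[1, 0, 0], [0, 0, 0], [0, 0, 0]],
     mat3_of_rows [[1, 0, 0], [0, 0, 0], [0, 0, -1]],
     mat3_of_rows [[1, 0, 0], [0, 0, 1], [0, 0, 0]],
     mat3_of_rows [[0, -1, 0], [1, 1, 0], [0, 0, 0]],
     mat3_of_rows [[0, -1, 0], [1, 1, 0], [0, 0, 1]],
     mat3_of_rows [[0, -1, 1], [1, 1, 0], [0, 0, 0]],
     mat3_of_rows [[0, 0, 0], [1, 0, 0], [0, 0, 0]],
     mat3_of_rows [[0, 0, 0], [1, 0, 0], [0, 0, -1]],
     mat3_of_rows [[0, -1, 0], [1, 0, 1], [0, 0, 0]]}
    \<union> {quantum_form 0 q | q. q \<noteq> 0}
    \<union> {quantum_form 1 q | q. q \<noteq> 0}"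

end

theory Submission
  imports Defs
begin

text \<open>
  A matrix \<open>M\<close> stands for the polynomial \<open>(x, y, 1) M (x, y, 1)\<^sup>T\<close> in two noncommuting variables.
  Two matrices have the same polynomial if and only if they have the same standard form, so that
  standard-form congruence is equivalence of polynomials under affine substitutions and scaling.
  Equivalently, in terms of matrices, it is simultaneous congruence, with a common scalar, of the
  homogeneous block \<open>A\<close> by the linear part and of \<open>T = M + M\<^sup>T\<close> by the whole affine matrix
  (\<open>sf_congruent_iff\<close>).

  Every polynomial with nonzero homogeneous part reduces to one in the list
  (\<open>reduces_nonzero_hom_block\<close>). Since the field is algebraically closed, the symmetric part of
  \<open>A\<close> has an isotropic vector. With it as first basis vector there is no \<open>x\<^sup>2\<close> left, and linear
  substitutions and scaling bring the homogeneous part to one of \<open>x\<^sup>2\<close>, \<open>y x - x y + y\<^sup>2\<close>, \<open>y x\<close> and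
  \<open>q y x - x y\<close> (\<open>reduces_without_x_square\<close>). A translation by \<open>w\<close> changes the linear part by
  \<open>(A + A\<^sup>T) w\<close>. Where \<open>S = A + A\<^sup>T\<close> is invertible this removes the linear part; where it is
  singular, a linear term that survives is normalized and then used to absorb the constant.

  The list has no further coincidences. Whether \<open>A\<close> is singular and the ranks of \<open>S\<close> and \<open>T\<close> are
  invariants (\<open>sf_profile_eq\<close>), and they separate all forms except members of the same family with
  parameter \<open>q\<close> (\<open>canonical_forms_distinct\<close>). An affine substitution followed by scaling
  multiplies the determinant of \<open>A\<close> by the square of the factor by which it multiplies the skew
  part of \<open>A\<close>. Hence the ratio \<open>q : (q + 1)\<^sup>2\<close> is an invariant within a family, and it takes the same value at \<open>p\<close> and \<open>q\<close>
  only for \<open>p = q\<close> and \<open>p = q\<^sup>-\<^sup>1\<close> (\<open>quantum_form_congruent_iff\<close>).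
\<close>

section \<open>Scaled matrices and affine substitutions\<close>

text \<open>The substitution of \<open>p x + q y + u\<close> for \<open>x\<close> and of \<open>r x + s y + v\<close> for \<open>y\<close>.\<close>

definition affine_mat :: "'k::field \<Rightarrow> 'k \<Rightarrow> 'k \<Rightarrow> 'k \<Rightarrow> 'k \<Rightarrow> 'k \<Rightarrow> 'k^3^3"
  where "affine_mat p q r s u v = mat3_of_rows [[p, q, u], [r, s, v], [0, 0, 1]]"

text \<open>The standard form that stands for the noncommutative polynomial
  \<open>a x\<^sup>2 + b x y + c y x + d y\<^sup>2 + e x + f y + m\<close>.\<close>

definition quad_poly :: "'k::field \<Rightarrow> 'k \<Rightarrow> 'k \<Rightarrow> 'k \<Rightarrow> 'k \<Rightarrow> 'k \<Rightarrow> 'k \<Rightarrow> 'k^3^3"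
  where "quad_poly a b c d e f m = mat3_of_rows [[a, b, e], [c, d, f], [0, 0, m]]"

abbreviation scale_mat :: "'k::field \<Rightarrow> 'k^'n^'m \<Rightarrow> 'k^'n^'m"
  where "scale_mat \<alpha> A \<equiv> map_matrix ((*) \<alpha>) A"

lemmas matrix_entries =
  mat2_of_rows_def mat3_of_rows_def block_mat_def hom_block_def col_block_def row_block_def
  corner_def affine_mat_def quad_poly_def vec_eq_iff forall_2 forall_3 sum_2 sum_3
  matrix_matrix_mult_def transpose_def map_matrix_def

lemma scale_mat_mult_left: "scale_mat c A ** B = scale_mat c (A ** B)"
  by (simp add: vec_eq_iff matrix_matrix_mult_def sum_distrib_left mult.assoc)

lemma scale_mat_mult_right: "A ** scale_mat c B = scale_mat c (A ** B)"
  by (simp add: vec_eq_iff matrix_matrix_mult_def sum_distrib_left mult.left_commute)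

lemma scale_mat_scale_mat: "scale_mat c (scale_mat d A) = scale_mat (c * d) A"
  by (simp add: vec_eq_iff mult.assoc)

lemma scale_mat_1: "scale_mat 1 A = A"
  by (simp add: vec_eq_iff)

lemma P3_eq: "P3 = {affine_mat p q r s u v | p q r s u v. p * s - q * r \<noteq> (0::'k::field)}"
proof -
  have "block_mat A b 0 1 = affine_mat (A$1$1) (A$1$2) (A$2$1) (A$2$2) (b$1) (b$2)"
    for A :: "'k^2^2" and b :: "'k^2"
    by (simp add: matrix_entries)
  moreover have det: "invertible A \<longleftrightarrow> A$1$1 * A$2$2 - A$1$2 * A$2$1 \<noteq> 0" for A :: "'k^2^2"
    by (simp add: invertible_det_nz det_2)
  moreover have "affine_mat p q r s u v = block_mat (mat2_of_rows [[p, q], [r, s]]) (vector [u, v]) 0 1"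
    for p q r s u v :: 'k
    by (simp add: matrix_entries)
  moreover have "invertible (mat2_of_rows [[p, q], [r, s]]) \<longleftrightarrow> p * s - q * r \<noteq> 0"
    for p q r s :: 'k
    by (simp add: det matrix_entries)
  ultimately show ?thesis
    unfolding P3_def by blast
qed

lemma P3_one: "mat 1 \<in> P3"
proof -
  have "(mat 1 :: 'k::field^3^3) = affine_mat 1 0 0 1 0 0"
    by (simp add: matrix_entries mat_def)
  then show ?thesis
    unfolding P3_eq by force
qed

lemma P3_mult:
  assumes "P \<in> P3" and "Q \<in> P3"
  shows "P ** Q \<in> P3"
proof -
  obtain p q r s u v where P: "P = affine_mat p q r s u v" and p: "p * s - q * r \<noteq> 0"
    using assms(1) unfolding P3_eq by blast
  obtain p' q' r' s' u' v' where Q: "Q = affine_mat p' q' r' s' u' v'" and q: "p' * s' - q' * r' \<noteq> 0"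
    using assms(2) unfolding P3_eq by blast
  have "P ** Q = affine_mat (p * p' + q * r') (p * q' + q * s') (r * p' + s * r') (r * q' + s * s')
      (p * u' + q * v' + u) (r * u' + s * v' + v)"
    by (simp add: P Q matrix_entries)
  moreover have "(p * p' + q * r') * (r * q' + s * s') - (p * q' + q * s') * (r * p' + s * r')
      = (p * s - q * r) * (p' * s' - q' * r')"
    by algebra
  ultimately show ?thesis
    using p q unfolding P3_eq by force
qed

lemma P3_inverse:
  assumes "P \<in> P3"
  obtains Q where "Q \<in> P3" and "P ** Q = mat 1"
proof -
  obtain p q r s u v where P: "P = affine_mat p q r s u v" and p: "p * s - q * r \<noteq> 0"
    using assms unfolding P3_eq by blast
  define D where "D = p * s - q * r"
  define Q where "Q = affine_mat (s / D) (- q / D) (- r / D) (p / D) ((q * v - s * u) / D) ((r * u - p * v) / D)"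
  have [simp]: "D \<noteq> 0" using p by (simp add: D_def)
  have "(s / D) * (p / D) - (- q / D) * (- r / D) = 1 / D"
    by (simp add: divide_simps) (simp add: D_def)
  then have "Q \<in> P3"
    unfolding P3_eq Q_def by force
  moreover have "P ** Q = mat 1"
    unfolding P Q_def
    by (simp add: matrix_entries mat_def divide_simps) (simp add: D_def algebra_simps)
  ultimately show ?thesis
    using that by blast
qed

lemma hom_block_mult:
  assumes "P \<in> P3"
  shows "hom_block (N ** P) = hom_block N ** hom_block P"
  using assms unfolding P3_eq by (auto simp: matrix_entries)

lemma hom_block_transpose_mult:
  assumes "P \<in> P3"
  shows "hom_block (transpose P ** N) = transpose (hom_block P) ** hom_block N"
  using assms unfolding P3_eq by (auto simp: matrix_entries)

lemma hom_block_one: "hom_block (mat 1) = mat 1"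
  by (simp add: matrix_entries mat_def)

section \<open>Standard-form congruence is an equivalence relation\<close>

text \<open>Passing to the standard form loses only how the linear coefficients are distributed over the last
  row and the last column; their sums are the corresponding entries of \<open>M + M\<^sup>T\<close>. Doubling the
  corner entry loses nothing in characteristic zero.\<close>

lemma sf_eq_iff:
  fixes M N :: "'k::field_char_0^3^3"
  shows "sf M = sf N \<longleftrightarrow> hom_block M = hom_block N \<and> M + transpose M = N + transpose N"
  by (auto simp: sf_def matrix_entries algebra_simps)

lemma sf_scale_mat: "scale_mat \<alpha> (sf M) = sf (scale_mat \<alpha> M)"
  by (simp add: sf_def matrix_entries algebra_simps)

text \<open>Unlike \<open>sf\<close>, the two maps \<open>M \<mapsto> hom_block M\<close> and \<open>M \<mapsto> M + M\<^sup>T\<close> commute with congruence.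
  This description therefore reduces the equivalence laws to the group laws of \<open>P3\<close>, and it is
  the source of all invariants.\<close>

lemma sf_congruent_iff:
  fixes M N :: "'k::field_char_0^3^3"
  shows "sf_congruent M N \<longleftrightarrow> (\<exists>P\<in>P3. \<exists>\<alpha>. \<alpha> \<noteq> 0
    \<and> hom_block M = scale_mat \<alpha> (transpose (hom_block P) ** hom_block N ** hom_block P)
    \<and> M + transpose M = scale_mat \<alpha> (transpose P ** (N + transpose N) ** P))"
proof -
  have "hom_block (scale_mat \<alpha> (transpose P ** N ** P))
      = scale_mat \<alpha> (transpose (hom_block P) ** hom_block N ** hom_block P)"
    if "P \<in> P3" for P and \<alpha> :: 'k
  proof -
    have "hom_block (scale_mat \<alpha> A) = scale_mat \<alpha> (hom_block A)" for A :: "'k^3^3"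
      by (simp add: matrix_entries)
    then show ?thesis
      by (simp add: hom_block_mult hom_block_transpose_mult that)
  qed
  moreover have "scale_mat \<alpha> (transpose P ** N ** P) + transpose (scale_mat \<alpha> (transpose P ** N ** P))
      = scale_mat \<alpha> (transpose P ** (N + transpose N) ** P)" for P :: "'k^3^3" and \<alpha> :: 'k
  proof -
    have "transpose (scale_mat \<alpha> A) = scale_mat \<alpha> (transpose A)"
      and "scale_mat \<alpha> A + scale_mat \<alpha> B = scale_mat \<alpha> (A + B)" for A B :: "'k^3^3"
      by (simp_all add: vec_eq_iff transpose_def algebra_simps)
    moreover have "transpose (transpose P ** N ** P) = transpose P ** transpose N ** P"
      by (simp add: matrix_transpose_mul matrix_mul_assoc)
    moreover have "A ** B + A ** C = A ** (B + C)" "B ** A + C ** A = (B + C) ** A" for A B C :: "'k^3^3"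
      by (simp_all add: vec_eq_iff matrix_matrix_mult_def sum.distrib algebra_simps)
    ultimately show ?thesis by simp
  qed
  ultimately show ?thesis
    unfolding sf_congruent_def sf_scale_mat sf_eq_iff by auto
qed

lemma sf_congruent_refl:
  fixes M :: "'k::field_char_0^3^3"
  shows "sf_congruent M M"
  unfolding sf_congruent_iff
  by (rule bexI[OF _ P3_one], rule exI[of _ 1])
    (simp add: hom_block_one transpose_mat scale_mat_1)

lemma sf_congruent_sym:
  fixes M N :: "'k::field_char_0^3^3"
  assumes "sf_congruent M N"
  shows "sf_congruent N M"
proof -
  obtain P \<alpha> where P: "P \<in> P3" and \<alpha>: "\<alpha> \<noteq> 0"
    and hom: "hom_block M = scale_mat \<alpha> (transpose (hom_block P) ** hom_block N ** hom_block P)"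
    and sym: "M + transpose M = scale_mat \<alpha> (transpose P ** (N + transpose N) ** P)"
    using assms unfolding sf_congruent_iff by blast
  obtain Q where Q: "Q \<in> P3" and PQ: "P ** Q = mat 1"
    using P3_inverse[OF P] by blast
  have PQ': "hom_block P ** hom_block Q = mat 1"
    using PQ hom_block_mult[OF Q] by (metis hom_block_one)
  have cancel: "transpose B ** (transpose A ** X ** A) ** B = X" if "A ** B = mat 1" for A B X :: "'k^'n^'n"
  proof -
    have "transpose B ** transpose A = mat 1"
      using that by (metis matrix_transpose_mul transpose_mat)
    then show ?thesis
      using that by (metis matrix_mul_assoc matrix_mul_lid matrix_mul_rid)
  qed
  show ?thesis
    unfolding sf_congruent_iff
    by (rule bexI[OF _ Q], rule exI[of _ "inverse \<alpha>"])
      (simp add: \<alpha> hom sym scale_mat_mult_left scale_mat_mult_right scale_mat_scale_mat scale_mat_1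
        cancel[OF PQ] cancel[OF PQ'])
qed

lemma sf_congruent_trans:
  fixes L M N :: "'k::field_char_0^3^3"
  assumes "sf_congruent L M" and "sf_congruent M N"
  shows "sf_congruent L N"
proof -
  obtain P \<alpha> where P: "P \<in> P3" and \<alpha>: "\<alpha> \<noteq> 0"
    and L: "hom_block L = scale_mat \<alpha> (transpose (hom_block P) ** hom_block M ** hom_block P)"
      "L + transpose L = scale_mat \<alpha> (transpose P ** (M + transpose M) ** P)"
    using assms(1) unfolding sf_congruent_iff by blast
  obtain Q \<beta> where Q: "Q \<in> P3" and \<beta>: "\<beta> \<noteq> 0"
    and M: "hom_block M = scale_mat \<beta> (transpose (hom_block Q) ** hom_block N ** hom_block Q)"
      "M + transpose M = scale_mat \<beta> (transpose Q ** (N + transpose N) ** Q)"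
    using assms(2) unfolding sf_congruent_iff by blast
  show ?thesis
    unfolding sf_congruent_iff
    by (rule bexI[OF _ P3_mult[OF Q P]], rule exI[of _ "\<alpha> * \<beta>"])
      (simp add: \<alpha> \<beta> L M scale_mat_mult_left scale_mat_mult_right scale_mat_scale_mat
        hom_block_mult[OF P] matrix_transpose_mul matrix_mul_assoc)
qed

section \<open>Invariants\<close>

text \<open>A factorization through a one-dimensional space is visibly stable under multiplication by
  arbitrary matrices on both sides, in every dimension and over every field.\<close>

definition rank_le_1 :: "'k::field^'n^'n \<Rightarrow> bool"
  where "rank_le_1 A \<longleftrightarrow> (\<exists>(V :: 'k^1^'n) (W :: 'k^'n^1). A = V ** W)"

text \<open>The profile encodes whether the homogeneous block is singular, the rank of its symmetrization
  \<open>S\<close> (a \<open>2 \<times> 2\<close> matrix, so that \<open>S = 0\<close> and \<open>det S = 0\<close> decide it) and the rank of the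
  symmetrization \<open>T\<close> of the whole matrix.\<close>

definition sf_profile :: "'k::field^3^3 \<Rightarrow> bool \<times> (bool \<times> bool) \<times> bool \<times> bool \<times> bool"
  where "sf_profile M = (let A = hom_block M; S = A + transpose A; T = M + transpose M
    in (det A = 0, (S = 0, det S = 0), T = 0, rank_le_1 T, det T = 0))"

lemma rank_le_1_congruence:
  fixes A P :: "'k::field^'n^'n"
  assumes "rank_le_1 A"
  shows "rank_le_1 (scale_mat \<alpha> (transpose P ** A ** P))"
proof -
  obtain V :: "'k^1^'n" and W :: "'k^'n^1" where "A = V ** W"
    using assms unfolding rank_le_1_def by blast
  then have "scale_mat \<alpha> (transpose P ** A ** P) = scale_mat \<alpha> (transpose P ** V) ** (W ** P)"
    by (simp add: scale_mat_mult_left matrix_mul_assoc)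
  then show ?thesis
    unfolding rank_le_1_def by blast
qed

lemma rank_le_1_minor:
  assumes "rank_le_1 A"
  shows "A$i$j * A$k$l = A$i$l * A$k$j"
  using assms unfolding rank_le_1_def
  by (auto simp: matrix_matrix_mult_def)

lemma det_congruence_eq_0:
  fixes A P :: "'k::field^'n^'n"
  assumes "det A = 0"
  shows "det (scale_mat \<alpha> (transpose P ** A ** P)) = 0"
proof -
  have "scale_mat \<alpha> B = mat \<alpha> ** B" for B :: "'k^'n^'n"
    by (simp add: vec_eq_iff matrix_matrix_mult_def mat_def if_distrib if_distribR cong: if_cong)
  then show ?thesis
    using assms by (simp add: det_mul)
qed

text \<open>Each entry of the profile says that a matrix which transforms by congruence and scaling is
  degenerate in some way. Congruence preserves degeneracy, and the converse follows by symmetry of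
  the relation.\<close>

lemma sf_profile_eq:
  fixes M N :: "'k::field_char_0^3^3"
  assumes "sf_congruent M N"
  shows "sf_profile M = sf_profile N"
proof -
  let ?S = "\<lambda>M :: 'k^3^3. hom_block M + transpose (hom_block M)"
  let ?T = "\<lambda>M :: 'k^3^3. M + transpose M"
  have *: "(det (hom_block N) = 0 \<longrightarrow> det (hom_block M) = 0) \<and> (?S N = 0 \<longrightarrow> ?S M = 0)
      \<and> (det (?S N) = 0 \<longrightarrow> det (?S M) = 0) \<and> (?T N = 0 \<longrightarrow> ?T M = 0)
      \<and> (rank_le_1 (?T N) \<longrightarrow> rank_le_1 (?T M)) \<and> (det (?T N) = 0 \<longrightarrow> det (?T M) = 0)"
    if "sf_congruent M N" for M N :: "'k^3^3"
  proof -
    obtain P \<alpha> where P: "P \<in> P3" and \<alpha>: "\<alpha> \<noteq> 0"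
      and A: "hom_block M = scale_mat \<alpha> (transpose (hom_block P) ** hom_block N ** hom_block P)"
      and T: "?T M = scale_mat \<alpha> (transpose P ** ?T N ** P)"
      using \<open>sf_congruent M N\<close> unfolding sf_congruent_iff by blast
    have zero: "scale_mat \<alpha> (0 :: 'k^'n^'n) = 0"
      by (simp add: vec_eq_iff)
    have hom: "hom_block (?T M) = ?S M" for M :: "'k^3^3"
      by (simp add: matrix_entries)
    have "hom_block (scale_mat \<alpha> X) = scale_mat \<alpha> (hom_block X)" for X :: "'k^3^3"
      by (simp add: matrix_entries)
    then have S: "?S M = scale_mat \<alpha> (transpose (hom_block P) ** ?S N ** hom_block P)"
      using T hom[of M] hom[of N] by (simp add: hom_block_mult hom_block_transpose_mult P)
    show ?thesis
      unfolding S T unfolding A by (auto simp: zero rank_le_1_congruence det_congruence_eq_0)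
  qed
  show ?thesis
    using *[OF assms] *[OF sf_congruent_sym[OF assms]]
    unfolding sf_profile_def Let_def by auto
qed

text \<open>If \<open>P\<^sub>1\<close> is the linear part of the substitution, then the determinant of the homogeneous
  block is multiplied by \<open>(\<alpha> det P\<^sub>1)\<^sup>2\<close>, and its skew part, which is a single number, by
  \<open>\<alpha> det P\<^sub>1\<close>. So the ratio of the determinant to the square of the skew part is an invariant.
  It is stated without division because either quantity may vanish.\<close>

lemma det_skew_ratio:
  fixes M N :: "'k::field_char_0^3^3"
  assumes "sf_congruent M N"
  shows "det (hom_block M) * (N$2$1 - N$1$2)\<^sup>2 = det (hom_block N) * (M$2$1 - M$1$2)\<^sup>2"
proof -
  obtain P \<alpha> where P: "P \<in> P3"
    and A: "hom_block M = scale_mat \<alpha> (transpose (hom_block P) ** hom_block N ** hom_block P)"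
    using assms unfolding sf_congruent_iff by blast
  obtain p q r s u v where P': "P = affine_mat p q r s u v"
    using P unfolding P3_eq by blast
  let ?D = "p * s - q * r"
  have "det (hom_block M) = (\<alpha> * ?D)\<^sup>2 * det (hom_block N)"
    unfolding A P' det_2 by (simp add: matrix_entries) (simp add: power2_eq_square algebra_simps)
  moreover have "M$2$1 - M$1$2 = \<alpha> * ?D * (N$2$1 - N$1$2)"
    using A unfolding P' by (simp add: matrix_entries) (simp add: algebra_simps)
  ultimately show ?thesis
    by (simp only: power_mult_distrib mult_ac)
qed

section \<open>Substitutions in quadratic polynomials\<close>

lemma canonical_forms_eq: "canonical_forms =
    {quad_poly 1 0 0 0 0 0 0, quad_poly 1 0 0 0 0 0 (-1), quad_poly 1 0 0 0 0 1 0,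
     quad_poly 0 (-1) 1 1 0 0 0, quad_poly 0 (-1) 1 1 0 0 1, quad_poly 0 (-1) 1 1 1 0 0,
     quad_poly 0 0 1 0 0 0 0, quad_poly 0 0 1 0 0 0 (-1), quad_poly 0 (-1) 1 0 0 1 0}
    \<union> {quantum_form 0 q | q. q \<noteq> 0} \<union> {quantum_form 1 q | q. q \<noteq> 0}"
  by (simp add: canonical_forms_def quad_poly_def)

lemma quantum_form_eq: "quantum_form m q = quad_poly 0 (-1) q 0 0 0 m"
  by (simp add: quantum_form_def quad_poly_def)

text \<open>The new coefficients are those of the polynomial that results from the substitution. They are
  given by equations in order that a use of the lemma can fix the target polynomial and leave only
  the verification of these equations.\<close>

lemma quad_poly_substitution:
  fixes a b c d e f m :: "'k::field_char_0"
  assumes "p * s - q * r \<noteq> 0" and "\<alpha> \<noteq> 0"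
    and "a' = \<alpha> * (a * p * p + b * p * r + c * r * p + d * r * r)"
    and "b' = \<alpha> * (a * p * q + b * p * s + c * r * q + d * r * s)"
    and "c' = \<alpha> * (a * q * p + b * q * r + c * s * p + d * s * r)"
    and "d' = \<alpha> * (a * q * q + b * q * s + c * s * q + d * s * s)"
    and "e' = \<alpha> * (p * (2 * a * u + (b + c) * v + e) + r * ((b + c) * u + 2 * d * v + f))"
    and "f' = \<alpha> * (q * (2 * a * u + (b + c) * v + e) + s * ((b + c) * u + 2 * d * v + f))"
    and "m' = \<alpha> * (a * u * u + (b + c) * u * v + d * v * v + e * u + f * v + m)"
  shows "sf_congruent (quad_poly a' b' c' d' e' f' m') (quad_poly a b c d e f m)"
proof -
  have "affine_mat p q r s u v \<in> P3"
    using assms(1) unfolding P3_eq by blast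
  moreover have "sf (quad_poly a' b' c' d' e' f' m') =
      scale_mat \<alpha> (sf (transpose (affine_mat p q r s u v) ** quad_poly a b c d e f m ** affine_mat p q r s u v))"
    unfolding assms(3-) by (simp add: sf_def matrix_entries algebra_simps)
  ultimately show ?thesis
    unfolding sf_congruent_def using assms(2) by blast
qed

text \<open>Used to normalize the homogeneous part first, when it does not matter what happens to the
  lower terms.\<close>

lemma quad_poly_linear_substitution:
  fixes a b c d e f m :: "'k::field_char_0"
  assumes "p * s - q * r \<noteq> 0" and "\<alpha> \<noteq> 0"
    and "a' = \<alpha> * (a * p * p + b * p * r + c * r * p + d * r * r)"
    and "b' = \<alpha> * (a * p * q + b * p * s + c * r * q + d * r * s)"
    and "c' = \<alpha> * (a * q * p + b * q * r + c * s * p + d * s * r)"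
    and "d' = \<alpha> * (a * q * q + b * q * s + c * s * q + d * s * s)"
  shows "\<exists>e' f' m'. sf_congruent (quad_poly a' b' c' d' e' f' m') (quad_poly a b c d e f m)"
  using quad_poly_substitution[OF assms, of _ 0 0 e f _ _ m] by blast

lemma sf_congruent_quad_poly:
  fixes M :: "'k::field_char_0^3^3"
  shows "sf_congruent (quad_poly (M$1$1) (M$1$2) (M$2$1) (M$2$2) (M$1$3 + M$3$1) (M$2$3 + M$3$2) (M$3$3)) M"
proof -
  have "sf (quad_poly (M$1$1) (M$1$2) (M$2$1) (M$2$2) (M$1$3 + M$3$1) (M$2$3 + M$3$2) (M$3$3)) = sf M"
    by (simp add: sf_def matrix_entries)
  then show ?thesis
    using sf_congruent_refl[of M] unfolding sf_congruent_def by simp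
qed

section \<open>Reduction to the canonical forms\<close>

abbreviation (input) reduces_to_canonical :: "'k::field^3^3 \<Rightarrow> bool"
  where "reduces_to_canonical M \<equiv> \<exists>N\<in>canonical_forms. sf_congruent M N"

lemma reduces_to_canonicalI:
  fixes M :: "'k::field_char_0^3^3"
  assumes "sf_congruent N M" and "N \<in> canonical_forms"
  shows "reduces_to_canonical M"
  using assms sf_congruent_sym by blast

lemma reduces_to_canonical_trans:
  fixes M :: "'k::field_char_0^3^3"
  assumes "sf_congruent N M" and "reduces_to_canonical N"
  shows "reduces_to_canonical M"
  using assms sf_congruent_sym sf_congruent_trans by blast

lemma square_root:
  fixes x :: "'k::alg_closed_field"
  obtains y where "y * y = x"
  using nth_root_exists[of 2 x] by (auto simp: power2_eq_square)

text \<open>Completing the square leaves \<open>x\<^sup>2 + f y + n\<close>. If \<open>f \<noteq> 0\<close>, then \<open>f y + n\<close> is taken as the new \<open>y\<close>;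
  otherwise a nonzero \<open>n\<close> is scaled to \<open>-1\<close> by a square root of \<open>-n\<close>.\<close>

lemma reduces_square:
  fixes e f m :: "'k::{alg_closed_field, field_char_0}"
  shows "reduces_to_canonical (quad_poly 1 0 0 0 e f m)"
proof -
  define n where "n = m - e * e / 4"
  consider "f \<noteq> 0" | "f = 0" "n = 0" | "f = 0" "n \<noteq> 0" by blast
  then show ?thesis
  proof cases
    case 1
    have "sf_congruent (quad_poly 1 0 0 0 0 1 0) (quad_poly 1 0 0 0 e f m)"
      by (rule quad_poly_substitution[where \<alpha> = 1 and p = 1 and q = 0 and r = 0 and s = "1 / f"
            and u = "- e / 2" and v = "- n / f"])
        (simp_all add: 1 n_def field_simps)
    then show ?thesis
      by (rule reduces_to_canonicalI) (simp add: canonical_forms_eq)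
  next
    case 2
    have "sf_congruent (quad_poly 1 0 0 0 0 0 0) (quad_poly 1 0 0 0 e f m)"
      by (rule quad_poly_substitution[where \<alpha> = 1 and p = 1 and q = 0 and r = 0 and s = 1
            and u = "- e / 2" and v = 0])
        (use 2 in \<open>simp_all add: n_def field_simps\<close>)
    then show ?thesis
      by (rule reduces_to_canonicalI) (simp add: canonical_forms_eq)
  next
    case 3
    obtain t where t: "t * t = - n" using square_root by blast
    have "sf_congruent (quad_poly 1 0 0 0 0 0 (-1)) (quad_poly 1 0 0 0 e f m)"
      by (rule quad_poly_substitution[where \<alpha> = "- 1 / n" and p = t and q = 0 and r = 0 and s = 1
            and u = "- e / 2" and v = 0])
        (use 3 t in \<open>auto simp: n_def field_simps\<close>)
    then show ?thesis
      by (rule reduces_to_canonicalI) (simp add: canonical_forms_eq)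
  qed
qed

text \<open>A translation does not change the linear part of \<open>y x - x y\<close>. So the shift of \<open>y\<close> that completes
  the square leaves \<open>y x - x y + y\<^sup>2 + e x + n\<close>. If \<open>e \<noteq> 0\<close>, then a shift of \<open>x\<close> absorbs \<open>n\<close>, and
  multiplying both variables by \<open>e\<close> multiplies all remaining terms by \<open>e\<^sup>2\<close>. Otherwise a nonzero
  \<open>n\<close> is scaled to \<open>1\<close> by multiplying both variables by a square root of \<open>n\<close>.\<close>

lemma reduces_skew_plus_square:
  fixes e f m :: "'k::{alg_closed_field, field_char_0}"
  shows "reduces_to_canonical (quad_poly 0 (-1) 1 1 e f m)"
proof -
  define n where "n = m - f * f / 4"
  consider "e \<noteq> 0" | "e = 0" "n = 0" | "e = 0" "n \<noteq> 0" by blast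
  then show ?thesis
  proof cases
    case 1
    have "sf_congruent (quad_poly 0 (-1) 1 1 1 0 0) (quad_poly 0 (-1) 1 1 e f m)"
      by (rule quad_poly_substitution[where \<alpha> = "1 / (e * e)" and p = e and q = 0 and r = 0 and s = e
            and u = "- n / e" and v = "- f / 2"])
        (simp_all add: 1 n_def field_simps)
    then show ?thesis
      by (rule reduces_to_canonicalI) (simp add: canonical_forms_eq)
  next
    case 2
    have "sf_congruent (quad_poly 0 (-1) 1 1 0 0 0) (quad_poly 0 (-1) 1 1 e f m)"
      by (rule quad_poly_substitution[where \<alpha> = 1 and p = 1 and q = 0 and r = 0 and s = 1
            and u = 0 and v = "- f / 2"])
        (use 2 in \<open>simp_all add: n_def field_simps\<close>)
    then show ?thesis
      by (rule reduces_to_canonicalI) (simp add: canonical_forms_eq)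
  next
    case 3
    obtain t where t: "t * t = n" using square_root by blast
    have "sf_congruent (quad_poly 0 (-1) 1 1 0 0 1) (quad_poly 0 (-1) 1 1 e f m)"
      by (rule quad_poly_substitution[where \<alpha> = "1 / n" and p = t and q = 0 and r = 0 and s = t
            and u = 0 and v = "- f / 2"])
        (use 3 t in \<open>auto simp: n_def field_simps\<close>)
    then show ?thesis
      by (rule reduces_to_canonicalI) (simp add: canonical_forms_eq)
  qed
qed

text \<open>Here \<open>y x + e x + f y + m = (y + e) (x + f) + (m - e f)\<close>.\<close>

lemma reduces_product:
  fixes e f m :: "'k::field_char_0"
  shows "reduces_to_canonical (quad_poly 0 0 1 0 e f m)"
proof -
  define n where "n = m - e * f"
  show ?thesis
  proof (cases "n = 0")
    case True
    have "sf_congruent (quad_poly 0 0 1 0 0 0 0) (quad_poly 0 0 1 0 e f m)"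
      by (rule quad_poly_substitution[where \<alpha> = 1 and p = 1 and q = 0 and r = 0 and s = 1
            and u = "- f" and v = "- e"])
        (use True in \<open>simp_all add: n_def field_simps\<close>)
    then show ?thesis
      by (rule reduces_to_canonicalI) (simp add: canonical_forms_eq)
  next
    case False
    have "sf_congruent (quad_poly 0 0 1 0 0 0 (-1)) (quad_poly 0 0 1 0 e f m)"
      by (rule quad_poly_substitution[where \<alpha> = "- 1 / n" and p = "- n" and q = 0 and r = 0 and s = 1
            and u = "- f" and v = "- e"])
        (use False in \<open>auto simp: n_def field_simps\<close>)
    then show ?thesis
      by (rule reduces_to_canonicalI) (simp add: canonical_forms_eq)
  qed
qed

lemma reduces_quantum_constant:
  fixes m q :: "'k::field_char_0"
  assumes "q \<noteq> 0"
  shows "reduces_to_canonical (quantum_form m q)"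
proof (cases "m = 0")
  case True
  then show ?thesis
    using assms sf_congruent_refl unfolding canonical_forms_eq by blast
next
  case False
  have "sf_congruent (quantum_form 1 q) (quantum_form m q)"
    unfolding quantum_form_eq
    by (rule quad_poly_substitution[where \<alpha> = "1 / m" and p = m and q = 0 and r = 0 and s = 1
          and u = 0 and v = 0])
      (use False in simp_all)
  then show ?thesis
    by (rule reduces_to_canonicalI) (use assms in \<open>auto simp: canonical_forms_eq\<close>)
qed

text \<open>For \<open>q \<noteq> 1\<close> the symmetrization of the homogeneous block is invertible, so that a translation
  removes the linear terms.\<close>

lemma reduces_quantum:
  fixes e f m q :: "'k::field_char_0"
  assumes "q \<noteq> 0" and "q \<noteq> 1"
  shows "reduces_to_canonical (quad_poly 0 (-1) q 0 e f m)"
proof -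
  define u v where "u = f / (1 - q)" and "v = e / (1 - q)"
  then have ef: "e = (1 - q) * v" "f = (1 - q) * u"
    using assms by simp_all
  have "sf_congruent (quantum_form (m + e * u) q) (quad_poly 0 (-1) q 0 e f m)"
    unfolding quantum_form_eq ef
    by (rule quad_poly_substitution[where \<alpha> = 1 and p = 1 and q = 0 and r = 0 and s = 1
          and u = u and v = v])
      (simp_all add: algebra_simps)
  then show ?thesis
    by (rule reduces_to_canonical_trans) (rule reduces_quantum_constant[OF assms(1)])
qed

text \<open>A substitution of determinant \<open>1\<close> fixes \<open>y x - x y\<close>. If \<open>e x + f y\<close> is not zero, then there is
  such a substitution under which \<open>e x + f y + m\<close> becomes the new \<open>y\<close>.\<close>

lemma reduces_commutator:
  fixes e f m :: "'k::field_char_0"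
  shows "reduces_to_canonical (quad_poly 0 (-1) 1 0 e f m)"
proof -
  have can: "quad_poly 0 (-1) 1 0 0 1 0 \<in> canonical_forms"
    by (simp add: canonical_forms_eq)
  consider "f \<noteq> 0" | "f = 0" "e \<noteq> 0" | "e = 0" "f = 0" by blast
  then show ?thesis
  proof cases
    case 1
    have "sf_congruent (quad_poly 0 (-1) 1 0 0 1 0) (quad_poly 0 (-1) 1 0 e f m)"
      by (rule quad_poly_substitution[where \<alpha> = 1 and p = f and q = 0 and r = "- e" and s = "1 / f"
            and u = 0 and v = "- m / f"])
        (simp_all add: 1)
    then show ?thesis
      using can by (rule reduces_to_canonicalI)
  next
    case 2
    have "sf_congruent (quad_poly 0 (-1) 1 0 0 1 0) (quad_poly 0 (-1) 1 0 e f m)"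
      by (rule quad_poly_substitution[where \<alpha> = 1 and p = 0 and q = "1 / e" and r = "- e" and s = 0
            and u = "- m / e" and v = 0])
        (simp_all add: 2)
    then show ?thesis
      using can by (rule reduces_to_canonicalI)
  next
    case 3
    then show ?thesis
      using reduces_quantum_constant[of 1 m] by (simp add: quantum_form_eq)
  qed
qed

lemma isotropic_vector:
  fixes a b d :: "'k::alg_closed_field"
  obtains x y where "x \<noteq> 0 \<or> y \<noteq> 0" and "a * x * x + b * x * y + d * y * y = 0"
proof (cases "a = 0")
  case True
  then show ?thesis using that[of 1 0] by simp
next
  case False
  then have "degree [:d, b, a:] > 0" by simp
  then obtain x where "poly [:d, b, a:] x = 0"
    using alg_closed_imp_poly_has_root by blast
  then show ?thesis using that[of x 1] by (simp add: algebra_simps)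
qed

text \<open>The homogeneous part is \<open>b x y + c y x + d y\<^sup>2\<close>. Its symmetrization is invertible if and only if
  \<open>b + c \<noteq> 0\<close>, and then adding a multiple of \<open>y\<close> to \<open>x\<close> removes \<open>d y\<^sup>2\<close>. The outcome is a multiple
  of \<open>y x\<close>, possibly after exchanging the variables, if one of \<open>b\<close> and \<open>c\<close> vanishes, and of a
  quantum form otherwise. For \<open>b + c = 0\<close> the homogeneous part is the sum of a skew form and a square.\<close>

lemma reduces_without_x_square:
  fixes b c d e f m :: "'k::{alg_closed_field, field_char_0}"
  assumes "b \<noteq> 0 \<or> c \<noteq> 0 \<or> d \<noteq> 0"
  shows "reduces_to_canonical (quad_poly 0 b c d e f m)" (is "reduces_to_canonical ?M")
proof -
  consider (square) "b = 0" "c = 0" "d \<noteq> 0"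
    | (skew) "b \<noteq> 0" "c = - b" "d = 0" | (jordan) "b \<noteq> 0" "c = - b" "d \<noteq> 0"
    | (left) "b = 0" "c \<noteq> 0" | (right) "b \<noteq> 0" "c = 0" | (quantum) "b \<noteq> 0" "c \<noteq> 0" "b + c \<noteq> 0"
    using assms by (metis add_eq_0_iff)
  then show ?thesis
  proof cases
    case square
    then obtain e' f' m' where "sf_congruent (quad_poly 1 0 0 0 e' f' m') ?M"
      using quad_poly_linear_substitution[where \<alpha> = "1 / d" and p = 0 and q = 1 and r = 1 and s = 0
          and a = 0 and b = b and c = c and d = d and a' = 1 and b' = 0 and c' = 0 and d' = 0 and e = e and f = f and m = m] by auto
    then show ?thesis
      using reduces_square by (rule reduces_to_canonical_trans)
  next
    case skew
    then obtain e' f' m' where "sf_congruent (quad_poly 0 (-1) 1 0 e' f' m') ?M"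
      using quad_poly_linear_substitution[where \<alpha> = "- 1 / b" and p = 1 and q = 0 and r = 0 and s = 1
          and a = 0 and b = b and c = c and d = d and a' = 0 and b' = "-1" and c' = 1 and d' = 0 and e = e and f = f and m = m] by auto
    then show ?thesis
      using reduces_commutator by (rule reduces_to_canonical_trans)
  next
    case jordan
    then obtain e' f' m' where "sf_congruent (quad_poly 0 (-1) 1 1 e' f' m') ?M"
      using quad_poly_linear_substitution[where \<alpha> = "d / (b * b)" and p = 1 and q = 0 and r = 0 and s = "- b / d"
          and a = 0 and b = b and c = c and d = d and a' = 0 and b' = "-1" and c' = 1 and d' = 1 and e = e and f = f and m = m] by auto
    then show ?thesis
      using reduces_skew_plus_square by (rule reduces_to_canonical_trans)
  next
    case left
    then obtain e' f' m' where "sf_congruent (quad_poly 0 0 1 0 e' f' m') ?M"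
      using quad_poly_linear_substitution[where \<alpha> = "1 / c" and p = 1 and q = "- d / c" and r = 0 and s = 1
          and a = 0 and b = b and c = c and d = d and a' = 0 and b' = 0 and c' = 1 and d' = 0 and e = e and f = f and m = m] by auto
    then show ?thesis
      using reduces_product by (rule reduces_to_canonical_trans)
  next
    case right
    then obtain e' f' m' where "sf_congruent (quad_poly 0 0 1 0 e' f' m') ?M"
      using quad_poly_linear_substitution[where \<alpha> = "1 / b" and p = "- d / b" and q = 1 and r = 1 and s = 0
          and a = 0 and b = b and c = c and d = d and a' = 0 and b' = 0 and c' = 1 and d' = 0 and e = e and f = f and m = m] by auto
    then show ?thesis
      using reduces_product by (rule reduces_to_canonical_trans)
  next
    case quantum
    define t where "t = d / (b + c)"
    then have d: "d = (b + c) * t"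
      using quantum by simp
    have "\<exists>e' f' m'. sf_congruent (quad_poly 0 (-1) (- c / b) 0 e' f' m') ?M"
      unfolding d
      by (rule quad_poly_linear_substitution[where \<alpha> = "- 1 / b" and p = 1 and q = "- t" and r = 0 and s = 1])
        (use quantum in \<open>simp_all add: algebra_simps\<close>)
    then obtain e' f' m' where "sf_congruent (quad_poly 0 (-1) (- c / b) 0 e' f' m') ?M"
      by blast
    then show ?thesis
      by (rule reduces_to_canonical_trans)
        (use quantum in \<open>auto intro!: reduces_quantum simp: divide_simps add_eq_0_iff2\<close>)
  qed
qed

text \<open>An isotropic vector of the symmetrized homogeneous block is taken as the first basis vector;
  this removes \<open>x\<^sup>2\<close>.\<close>

lemma reduces_nonzero_hom_block:
  fixes M :: "'k::{alg_closed_field, field_char_0}^3^3"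
  assumes "hom_block M \<noteq> 0"
  shows "reduces_to_canonical M"
proof -
  obtain a b c d e f m where M: "sf_congruent (quad_poly a b c d e f m) M"
    and nz: "a \<noteq> 0 \<or> b \<noteq> 0 \<or> c \<noteq> 0 \<or> d \<noteq> 0"
    using assms sf_congruent_quad_poly[of M] by (auto simp: matrix_entries)
  obtain x y where xy: "x \<noteq> 0 \<or> y \<noteq> 0" and "a * x * x + (b + c) * x * y + d * y * y = 0"
    using isotropic_vector by blast
  then have iso: "a * x * x + b * x * y + c * y * x + d * y * y = 0"
    by (simp add: algebra_simps)
  \<comment> \<open>The isotropic vector is completed to a basis.\<close>
  obtain q s where D: "x * s - q * y \<noteq> 0"
    using xy by (metis diff_0_right diff_0 mult_1_right mult_1 mult_zero_left mult_zero_right neg_equal_0_iff_equal)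
  define b' c' d' where "b' = a * x * q + b * x * s + c * y * q + d * y * s"
    and "c' = a * q * x + b * q * y + c * s * x + d * s * y"
    and "d' = a * q * q + b * q * s + c * s * q + d * s * s"
  obtain e' f' m' where M': "sf_congruent (quad_poly 0 b' c' d' e' f' m') (quad_poly a b c d e f m)"
    using quad_poly_linear_substitution[OF D, of 1 0 a b c d b' c' d' e f m] iso
    by (auto simp: b'_def c'_def d'_def)
  have "b' \<noteq> 0 \<or> c' \<noteq> 0 \<or> d' \<noteq> 0"
  proof (rule ccontr)
    assume zero: "\<not> ?thesis"
    \<comment> \<open>The new homogeneous block is \<open>P\<^sub>1\<^sup>T A P\<^sub>1\<close> with \<open>det P\<^sub>1 = x s - q y\<close>. Multiplying it by the adjugates
      of \<open>P\<^sub>1\<^sup>T\<close> and \<open>P\<^sub>1\<close> gives back \<open>(det P\<^sub>1)\<^sup>2 A\<close>.\<close>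
    have "(x * s - q * y) * (x * s - q * y) * a = 0" "(x * s - q * y) * (x * s - q * y) * b = 0"
      "(x * s - q * y) * (x * s - q * y) * c = 0" "(x * s - q * y) * (x * s - q * y) * d = 0"
      using zero iso unfolding b'_def c'_def d'_def not_not de_Morgan_disj by algebra+
    then show False using D nz by simp
  qed
  then have "reduces_to_canonical (quad_poly a b c d e f m)"
    using M' reduces_without_x_square reduces_to_canonical_trans by blast
  then show ?thesis
    using M reduces_to_canonical_trans by blast
qed

section \<open>The invariants separate the canonical forms\<close>

lemma rank_le_1_single:
  fixes x :: "'k::field" and k :: "'n::finite"
  shows "rank_le_1 (\<chi> i j. if i = k \<and> j = k then x else 0)"
proof -
  have "(\<chi> i j. if i = k \<and> j = k then x else 0) =
      (\<chi> i (_ :: 1). if i = k then x else 0) ** (\<chi> (_ :: 1) j. if j = k then 1 else 0)"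
    by (simp add: vec_eq_iff matrix_matrix_mult_def)
  then show ?thesis
    unfolding rank_le_1_def by blast
qed

lemma sf_profile_quad_poly:
  fixes a b c d e f m :: "'k::field_char_0"
  shows "sf_profile (quad_poly a b c d e f m) =
    (a * d = b * c,
     (a = 0 \<and> b + c = 0 \<and> d = 0, 4 * a * d = (b + c)\<^sup>2),
     a = 0 \<and> b + c = 0 \<and> d = 0 \<and> e = 0 \<and> f = 0 \<and> m = 0,
     rank_le_1 (mat3_of_rows [[2 * a, b + c, e], [b + c, 2 * d, f], [e, f, 2 * m]]),
     4 * a * d * m + (b + c) * e * f = a * f\<^sup>2 + d * e\<^sup>2 + m * (b + c)\<^sup>2)"
proof -
  let ?M = "quad_poly a b c d e f m"
  let ?T = "mat3_of_rows [[2 * a, b + c, e], [b + c, 2 * d, f], [e, f, 2 * m]]"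
  let ?S = "mat2_of_rows [[2 * a, b + c], [b + c, 2 * d]]"
  have T: "?M + transpose ?M = ?T"
    and S: "hom_block ?M + transpose (hom_block ?M) = ?S"
    by (simp_all add: matrix_entries add.commute)
  have "det (hom_block ?M) = a * d - b * c"
    by (simp add: det_2 matrix_entries)
  moreover have "?S = 0 \<longleftrightarrow> a = 0 \<and> b + c = 0 \<and> d = 0"
    "?T = 0 \<longleftrightarrow> a = 0 \<and> b + c = 0 \<and> d = 0 \<and> e = 0 \<and> f = 0 \<and> m = 0"
    by (auto simp: matrix_entries)
  moreover have "det ?S = 4 * a * d - (b + c)\<^sup>2"
    by (simp add: det_2 matrix_entries power2_eq_square)
  moreover have "det ?T = 0 \<longleftrightarrow> 4 * a * d * m + (b + c) * e * f = a * f\<^sup>2 + d * e\<^sup>2 + m * (b + c)\<^sup>2"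
  proof -
    have "det ?T = 2 * (4 * a * d * m + (b + c) * e * f - (a * f\<^sup>2 + d * e\<^sup>2 + m * (b + c)\<^sup>2))"
      by (simp add: det_3 mat3_of_rows_def) algebra
    moreover have "2 * (x - y) = 0 \<longleftrightarrow> x = y" for x y :: 'k
      by simp
    ultimately show ?thesis by (simp only:)
  qed
  ultimately show ?thesis
    unfolding sf_profile_def Let_def T S by simp
qed

text \<open>At \<open>q = 1\<close> the symmetrized homogeneous block drops from rank \<open>2\<close> to rank \<open>0\<close>. This separates
  the commutator from the other quantum forms, and also from \<open>y x - x y + y\<^sup>2\<close>, for which the rank
  is \<open>1\<close>.\<close>

lemma sf_profile_quantum_form:
  fixes q m :: "'k::field_char_0"
  assumes "q \<noteq> 0"
  shows "sf_profile (quantum_form m q) = (False, (q = 1, q = 1), q = 1 \<and> m = 0, q = 1, q = 1 \<or> m = 0)"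
proof -
  let ?T = "mat3_of_rows [[0, q - 1, 0], [q - 1, 0, 0], [0, 0, 2 * m]]"
  have "rank_le_1 ?T \<longleftrightarrow> q = 1"
  proof
    assume "rank_le_1 ?T"
    from rank_le_1_minor[OF this, of 1 2 2 1] show "q = 1"
      by (simp add: mat3_of_rows_def)
  next
    assume "q = 1"
    then have "?T = (\<chi> i j. if i = 3 \<and> j = 3 then 2 * m else 0)"
      by (simp add: matrix_entries)
    then show "rank_le_1 ?T"
      using rank_le_1_single by metis
  qed
  then show ?thesis
    using assms by (auto simp: quantum_form_eq sf_profile_quad_poly)
qed

lemma rank_le_1_squares:
  fixes x :: "'k::field"
  shows "rank_le_1 (mat3_of_rows [[x, 0, 0], [0, 0, 0], [0, 0, 0]])"
    and "rank_le_1 (mat3_of_rows [[0, 0, 0], [0, x, 0], [0, 0, 0]])"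
proof -
  have "mat3_of_rows [[x, 0, 0], [0, 0, 0], [0, 0, 0]] = (\<chi> i j. if i = 1 \<and> j = 1 then x else 0)"
    "mat3_of_rows [[0, 0, 0], [0, x, 0], [0, 0, 0]] = (\<chi> i j. if i = 2 \<and> j = 2 then x else 0)"
    by (simp_all add: matrix_entries)
  then show "rank_le_1 (mat3_of_rows [[x, 0, 0], [0, 0, 0], [0, 0, 0]])"
    and "rank_le_1 (mat3_of_rows [[0, 0, 0], [0, x, 0], [0, 0, 0]])"
    using rank_le_1_single by metis+
qed

lemma rank_le_1_principal_minors:
  fixes a b c d e f :: "'k::field"
  assumes "rank_le_1 (mat3_of_rows [[a, b, c], [b, d, e], [c, e, f]])"
  shows "a * d = b * b \<and> a * f = c * c \<and> d * f = e * e"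
  using rank_le_1_minor[OF assms, of 1 1 2 2] rank_le_1_minor[OF assms, of 1 1 3 3]
    rank_le_1_minor[OF assms, of 2 2 3 3]
  by (simp add: mat3_of_rows_def)

lemma sf_profile_canonical_forms:
  "sf_profile (quad_poly 1 0 0 0 0 0 (0 :: 'k::field_char_0)) = (True, (False, True), False, True, True)"
  "sf_profile (quad_poly 1 0 0 0 0 0 (-1 :: 'k)) = (True, (False, True), False, False, True)"
  "sf_profile (quad_poly 1 0 0 0 0 1 (0 :: 'k)) = (True, (False, True), False, False, False)"
  "sf_profile (quad_poly 0 (-1) 1 1 0 0 (0 :: 'k)) = (False, (False, True), False, True, True)"
  "sf_profile (quad_poly 0 (-1) 1 1 0 0 (1 :: 'k)) = (False, (False, True), False, False, True)"
  "sf_profile (quad_poly 0 (-1) 1 1 1 0 (0 :: 'k)) = (False, (False, True), False, False, False)"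
  "sf_profile (quad_poly 0 0 1 0 0 0 (0 :: 'k)) = (True, (False, False), False, False, True)"
  "sf_profile (quad_poly 0 0 1 0 0 0 (-1 :: 'k)) = (True, (False, False), False, False, False)"
  "sf_profile (quad_poly 0 (-1) 1 0 0 1 (0 :: 'k)) = (False, (True, True), False, False, True)"
  by (simp_all add: sf_profile_quad_poly rank_le_1_squares)
    (auto dest: rank_le_1_principal_minors)

text \<open>The profile takes pairwise different values on the nine single forms, none of which is the
  value at a quantum form, and it determines the corner entry \<open>m\<close> of a quantum form.\<close>

lemma canonical_forms_distinct:
  fixes M N :: "'k::field_char_0^3^3"
  assumes "M \<in> canonical_forms" and "N \<in> canonical_forms" and "sf_congruent M N"
  shows "M = N \<or> (\<exists>m\<in>{0, 1}. \<exists>p q. p \<noteq> 0 \<and> q \<noteq> 0 \<and> M = quantum_form m p \<and> N = quantum_form m q)"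
proof -
  define F :: "('k^3^3) set" where "F =
    {quad_poly 1 0 0 0 0 0 0, quad_poly 1 0 0 0 0 0 (-1), quad_poly 1 0 0 0 0 1 0,
     quad_poly 0 (-1) 1 1 0 0 0, quad_poly 0 (-1) 1 1 0 0 1, quad_poly 0 (-1) 1 1 1 0 0,
     quad_poly 0 0 1 0 0 0 0, quad_poly 0 0 1 0 0 0 (-1), quad_poly 0 (-1) 1 0 0 1 0}"
  have cases: "X \<in> F \<or> (\<exists>m\<in>{0, 1}. \<exists>q. q \<noteq> 0 \<and> X = quantum_form m q)" if "X \<in> canonical_forms" for X
    using that unfolding canonical_forms_eq F_def by blast
  have F_inj: "\<forall>X\<in>F. \<forall>Y\<in>F. sf_profile X = sf_profile Y \<longrightarrow> X = Y"
    unfolding F_def by (simp add: sf_profile_canonical_forms)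
  have F_quantum: "\<forall>X\<in>F. sf_profile X \<noteq> sf_profile (quantum_form m q)" if "q \<noteq> 0" for m q :: 'k
    unfolding F_def using that by (auto simp: sf_profile_canonical_forms sf_profile_quantum_form)
  have quantum_inj: "m = n" if "m \<in> {0, 1}" "n \<in> {0, 1}" "p \<noteq> 0" "q \<noteq> 0"
    "sf_profile (quantum_form m p) = sf_profile (quantum_form n q)" for m n p q :: 'k
    using that by (auto simp: sf_profile_quantum_form)
  have eq: "sf_profile M = sf_profile N"
    using assms(3) by (rule sf_profile_eq)
  show ?thesis
    using cases[OF assms(1)]
  proof (elim disjE bexE exE conjE)
    assume M: "M \<in> F"
    then have "N \<in> F"
      using cases[OF assms(2)] F_quantum eq by metis
    then show ?thesis
      using F_inj M eq by simp
  next
    fix m p :: 'k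
    assume m: "m \<in> {0, 1}" and p: "p \<noteq> 0" and M: "M = quantum_form m p"
    then have "N \<notin> F"
      using F_quantum eq by metis
    then obtain n q where n: "n \<in> {0, 1}" and q: "q \<noteq> 0" and N: "N = quantum_form n q"
      using cases[OF assms(2)] by blast
    have "m = n"
      using quantum_inj[OF m n p q] eq M N by simp
    then show ?thesis
      using m p q M N by blast
  qed
qed

text \<open>The ratio of determinant to squared skew part is \<open>q : (q + 1)\<^sup>2\<close>, which determines \<open>q\<close> up to
  inversion. Conversely, exchanging the variables exchanges the roles of \<open>-1\<close> and \<open>q\<close>; the factor
  \<open>-1 / q\<close> on one variable restores the coefficient \<open>-1\<close> and does not touch the constant term.\<close>

lemma quantum_form_congruent_iff:
  fixes p q m :: "'k::field_char_0"
  assumes "p \<noteq> 0" and "q \<noteq> 0"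
  shows "sf_congruent (quantum_form m p) (quantum_form m q) \<longleftrightarrow> p = q \<or> p = inverse q"
proof
  assume "sf_congruent (quantum_form m p) (quantum_form m q)"
  from det_skew_ratio[OF this] have "p * (q + 1)\<^sup>2 = q * (p + 1)\<^sup>2"
    by (simp add: quantum_form_def matrix_entries det_2)
  then have "(p - q) * (p * q - 1) = 0"
    by algebra
  then have "p = q \<or> p * q = 1"
    by (simp only: mult_eq_0_iff right_minus_eq)
  then show "p = q \<or> p = inverse q"
    using assms(2) by (auto simp: eq_divide_eq inverse_eq_divide)
next
  assume "p = q \<or> p = inverse q"
  then show "sf_congruent (quantum_form m p) (quantum_form m q)"
  proof
    assume "p = inverse q"
    show ?thesis
      unfolding quantum_form_eq \<open>p = inverse q\<close>
      by (rule quad_poly_substitution[where \<alpha> = 1 and p = 0 and q = "- 1 / q" and r = 1 and s = 0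
            and u = 0 and v = 0])
        (use assms in \<open>simp_all add: field_simps\<close>)
  qed (simp add: sf_congruent_refl)
qed

theorem theorem4p2:
  shows "(\<forall>N \<in> (canonical_forms :: ('k::{alg_closed_field, field_char_0}^3^3) set). hom_block N \<noteq> 0)
    \<and> (\<forall>M::'k^3^3. hom_block M \<noteq> 0 \<longrightarrow> (\<exists>N\<in>canonical_forms. sf_congruent M N))
    \<and> (\<forall>M \<in> (canonical_forms :: ('k^3^3) set). \<forall>N\<in>canonical_forms. M \<noteq> N
          \<and> \<not> (\<exists>m\<in>{0, 1}. \<exists>p q. p \<noteq> 0 \<and> q \<noteq> 0 \<and> M = quantum_form m p \<and> N = quantum_form m q)
          \<longrightarrow> \<not> sf_congruent M N)
    \<and> (\<forall>m\<in>{0, 1}. \<forall>p q :: 'k. p \<noteq> 0 \<longrightarrow> q \<noteq> 0 \<longrightarrow>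
          (sf_congruent (quantum_form m p) (quantum_form m q) \<longleftrightarrow> p = q \<or> p = inverse q))"
proof (intro conjI)
  show "\<forall>N \<in> (canonical_forms :: ('k^3^3) set). hom_block N \<noteq> 0"
    by (auto simp: canonical_forms_eq quantum_form_eq matrix_entries)
  show "\<forall>M::'k^3^3. hom_block M \<noteq> 0 \<longrightarrow> (\<exists>N\<in>canonical_forms. sf_congruent M N)"
    using reduces_nonzero_hom_block by blast
  show "\<forall>M \<in> (canonical_forms :: ('k^3^3) set). \<forall>N\<in>canonical_forms. M \<noteq> N
          \<and> \<not> (\<exists>m\<in>{0, 1}. \<exists>p q. p \<noteq> 0 \<and> q \<noteq> 0 \<and> M = quantum_form m p \<and> N = quantum_form m q)
          \<longrightarrow> \<not> sf_congruent M N"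
    by (intro ballI impI notI) (elim conjE notE[of "Bex _ _"], drule (2) canonical_forms_distinct, simp)
  show "\<forall>m\<in>{0, 1}. \<forall>p q :: 'k. p \<noteq> 0 \<longrightarrow> q \<noteq> 0 \<longrightarrow>
          (sf_congruent (quantum_form m p) (quantum_form m q) \<longleftrightarrow> p = q \<or> p = inverse q)"
    by (intro ballI allI impI quantum_form_congruent_iff)
qed

end
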